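(* For any triangle in the hyperbolic plane $\mathcal{H}$, one of the following three alternatives holds for its altitudes: (1) two of the altitudes intersect in a point of $\mathcal{H}$, and in that case the remaining altitude also passes through the same point; (2) two of the altitudes are asymptotically parallel, i.e. have a common point on the boundary at infinity of $\mathcal{H}$, and in that case the remaining altitude also passes through the same point at infinity; (3) two of the altitudes are divergently parallel, i.e. they are orthogonal to a common hyperbolic line, and in that case the third altitude is also orthogonal to that common line.
   Context: The hyperbolic plane is the upper half plane $\mathcal{H}=\{(x,y)\in\mathbb{R}^2: y>0\}$. A hyperbolic line is the part lying in $\mathcal{H}$ of a Euclidean line or of a Euclidean circle of positive radius in $\mathbb{R}^2$ that is orthogonal to the $x$-axis (i.e. the upper half of a vertical line, or the upper semicircle of a circle centered on the $x$-axis). Two hyperbolic lines are orthogonal if the corresponding Euclidean lines or circles are orthogonal in the classical Euclidean sense. The boundary at infinity of $\mathcal{H}$ is the $x$-axis $\{(x,0)\}$ together with one extra point $\infty$; a point $(x,0)$ lies on a hyperbolic line if it lies on the corresponding Euclidean line or circle, and $\infty$ lies exactly on the hyperbolic lines that are upper halves of vertical lines. A triangle is given by three points of $\mathcal{H}$ not on a common hyperbolic line; its sides are the three hyperbolic lines through pairs of vertices. The altitude through a vertex is the (unique) hyperbolic line passing through that vertex and orthogonal to the opposite side. In each alternative, the implication is asserted for any two of the three altitudes with the stated property. *)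

theory Defs
  imports "HOL-Analysis.Analysis"
begin

type_synonym point = "real \<times> real"

definition x_axis :: "point set" where
  "x_axis = {(x, y). y = 0}"

definition upper_half_plane :: "point set" where
  "upper_half_plane = {(x, y). y > 0}"

definition euclidean_line :: "point set \<Rightarrow> bool" where
  "euclidean_line L \<longleftrightarrow> (\<exists>p v. v \<noteq> 0 \<and> L = range (\<lambda>t. p + t *\<^sub>R v))"

definition euclidean_circle :: "point set \<Rightarrow> bool" where
  "euclidean_circle K \<longleftrightarrow> (\<exists>c r. r > 0 \<and> K = sphere c r)"

definition tangent_vector :: "point set \<Rightarrow> point \<Rightarrow> point \<Rightarrow> bool" where
  "tangent_vector K p v \<longleftrightarrow> p \<in> K \<and> v \<noteq> 0 \<and>
     (K = range (\<lambda>t. p + t *\<^sub>R v) \<or>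
      (\<exists>c r. r > 0 \<and> K = sphere c r \<and> orthogonal (p - c) v))"

text \<open>Classical orthogonality of lines and circles: the two curves meet, and their tangents
  are perpendicular at every common point.\<close>

definition euclidean_orthogonal :: "point set \<Rightarrow> point set \<Rightarrow> bool" where
  "euclidean_orthogonal K L \<longleftrightarrow>
     (euclidean_line K \<or> euclidean_circle K) \<and> (euclidean_line L \<or> euclidean_circle L) \<and>
     K \<inter> L \<noteq> {} \<and>
     (\<forall>p \<in> K \<inter> L. \<forall>v w. tangent_vector K p v \<longrightarrow> tangent_vector L p w \<longrightarrow> orthogonal v w)"

text \<open>\<open>carries K l\<close>: the Euclidean line or circle \<open>K\<close> corresponds to the hyperbolic line \<open>l\<close>.\<close>

definition carries :: "point set \<Rightarrow> point set \<Rightarrow> bool" where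
  "carries K l \<longleftrightarrow> (euclidean_line K \<or> euclidean_circle K) \<and>
     euclidean_orthogonal K x_axis \<and> l = K \<inter> upper_half_plane"

definition hyperbolic_line :: "point set \<Rightarrow> bool" where
  "hyperbolic_line l \<longleftrightarrow> (\<exists>K. carries K l)"

definition hyperbolic_orthogonal :: "point set \<Rightarrow> point set \<Rightarrow> bool" where
  "hyperbolic_orthogonal l m \<longleftrightarrow>
     (\<exists>K L. carries K l \<and> carries L m \<and> euclidean_orthogonal K L)"

datatype boundary_point = Axis_Point real | Infinity_Point

text \<open>A Euclidean line that carries a hyperbolic line is orthogonal to the axis, hence vertical.\<close>

fun boundary_point_on :: "boundary_point \<Rightarrow> point set \<Rightarrow> bool" where
  "boundary_point_on (Axis_Point x) l \<longleftrightarrow> (\<exists>K. carries K l \<and> (x, 0) \<in> K)"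
| "boundary_point_on Infinity_Point l \<longleftrightarrow> (\<exists>K. carries K l \<and> euclidean_line K)"

definition hyperbolic_triangle :: "point \<Rightarrow> point \<Rightarrow> point \<Rightarrow> bool" where
  "hyperbolic_triangle A B C \<longleftrightarrow>
     A \<in> upper_half_plane \<and> B \<in> upper_half_plane \<and> C \<in> upper_half_plane \<and>
     \<not> (\<exists>l. hyperbolic_line l \<and> A \<in> l \<and> B \<in> l \<and> C \<in> l)"

definition side :: "point \<Rightarrow> point \<Rightarrow> point set" where
  "side A B = (THE l. hyperbolic_line l \<and> A \<in> l \<and> B \<in> l)"

text \<open>\<open>altitude A B C\<close> is the altitude through \<open>A\<close> of the triangle \<open>A B C\<close>.\<close>

definition altitude :: "point \<Rightarrow> point \<Rightarrow> point \<Rightarrow> point set" where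
  "altitude A B C = (THE l. hyperbolic_line l \<and> A \<in> l \<and> hyperbolic_orthogonal l (side B C))"

end

theory Submission
  imports Defs "HOL-Library.Quadratic_Discriminant"
begin

text \<open>
  A hyperbolic line is the zero set in the upper half plane of
  \<open>a (x\<^sup>2 + y\<^sup>2) + b x + c\<close> with \<open>b\<^sup>2 - 4 a c > 0\<close>, so it is a vector of positive
  discriminant, up to scaling. The polar form of the discriminant makes the space of coefficient
  vectors a Lorentzian space in which points of the plane are the negative vectors, boundary points
  the null vectors, and both incidence and orthogonality mean that the pairing vanishes. The
  Wronskian of the quadratics \<open>a X\<^sup>2 + b X + c\<close> makes this space a Lie algebra (isomorphic to
  \<open>sl\<^sub>2\<close>) whose bracket is a Lorentzian cross product. Hence the side through \<open>B\<close> and \<open>C\<close>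
  is \<open>[B, C]\<close>, the altitude through \<open>A\<close> is \<open>[A, [B, C]]\<close>, and by the Jacobi identity
  the three altitude vectors add up to zero: whatever is incident with or orthogonal to two of them
  is so to the third. The sign of the discriminant of the bracket of two altitudes decides between
  the three alternatives.
\<close>

section \<open>Lorentzian algebra of coefficient vectors\<close>

type_synonym form = "real \<times> real \<times> real"

fun pairing :: "form \<Rightarrow> form \<Rightarrow> real" where
  "pairing (a, b, c) (a', b', c') = b * b' - 2 * a * c' - 2 * a' * c"

text \<open>For quadratics \<open>f\<close> and \<open>g\<close> with these coefficients, the
  coefficients of \<open>f' g - f g'\<close>, whose cubic terms cancel.\<close>

fun bracket :: "form \<Rightarrow> form \<Rightarrow> form" where
  "bracket (a, b, c) (a', b', c') = (a * b' - a' * b, 2 * (a * c' - a' * c), b * c' - b' * c)"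

text \<open>The quadratic with roots \<open>x \<plusminus> i y\<close>.\<close>

fun point_form :: "point \<Rightarrow> form" where
  "point_form (x, y) = (1, - 2 * x, x\<^sup>2 + y\<^sup>2)"

text \<open>Incidence is encoded as a vanishing pairing so that it has the same linear shape as
  orthogonality.\<close>

definition carrier :: "form \<Rightarrow> point set" where
  "carrier u = {P. pairing (point_form P) u = 0}"

definition hline :: "form \<Rightarrow> point set" where
  "hline u = carrier u \<inter> upper_half_plane"

lemma mem_carrier:
  "(x, y) \<in> carrier (a, b, c) \<longleftrightarrow> a * (x\<^sup>2 + y\<^sup>2) + b * x + c = 0"
proof -
  have "pairing (point_form (x, y)) (a, b, c) = - 2 * (a * (x\<^sup>2 + y\<^sup>2) + b * x + c)"
    by (simp add: algebra_simps)
  then show ?thesis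
    by (simp only: carrier_def mem_Collect_eq mult_eq_0_iff) simp
qed

lemma bracket_jacobi:
  "bracket u (bracket v w) + bracket v (bracket w u) + bracket w (bracket u v) = 0"
  by (cases u; cases v; cases w) (simp add: zero_prod_def algebra_simps)

text \<open>The Lorentzian counterpart of the expansion of a double cross product.\<close>

lemma bracket_bracket:
  "bracket (bracket u v) w = pairing v w *\<^sub>R u - pairing u w *\<^sub>R v"
  by (cases u; cases v; cases w) (simp add: algebra_simps)

lemma pairing_bracket [simp]:
  "pairing u (bracket u v) = 0" "pairing v (bracket u v) = 0"
  "pairing (bracket u v) u = 0" "pairing (bracket u v) v = 0"
  by (cases u; cases v; simp add: algebra_simps)+

text \<open>Lagrange's identity with Lorentzian sign: minus the Gram determinant of \<open>u\<close>
  and \<open>v\<close>. It determines the sign of a bracket from the signs of its arguments.\<close>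

lemma pairing_bracket_self:
  "pairing (bracket u v) (bracket u v) = (pairing u v)\<^sup>2 - pairing u u * pairing v v"
  by (cases u; cases v) (simp add: algebra_simps power2_eq_square)

lemma pairing_commute: "pairing u v = pairing v u"
  by (cases u; cases v) (simp add: algebra_simps)

lemma pairing_scaleR [simp]:
  "pairing (k *\<^sub>R u) v = k * pairing u v" "pairing u (k *\<^sub>R v) = k * pairing u v"
  by (cases u; cases v; simp add: algebra_simps)+

lemma pairing_add_right: "pairing u (v + w) = pairing u v + pairing u w"
  by (cases u; cases v; cases w) (simp add: algebra_simps)

text \<open>Up to a factor 2, the entries of the bracket are the 2 by 2 minors of the matrix with
  rows \<open>u\<close> and \<open>v\<close>; a nonzero entry of \<open>u\<close> then gives the
  ratio.\<close>

lemma bracket_eq_0_imp_scaleR: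
  assumes "bracket u v = 0" and "u \<noteq> 0"
  obtains k where "v = k *\<^sub>R u"
proof -
  obtain a b c a' b' c' where uv: "u = (a, b, c)" "v = (a', b', c')"
    by (cases u; cases v) auto
  have eqs: "a * b' = a' * b" "a * c' = a' * c" "b * c' = b' * c"
    using assms(1) by (auto simp: uv zero_prod_def)
  consider "a \<noteq> 0" | "b \<noteq> 0" | "c \<noteq> 0"
    using assms(2) by (auto simp: uv zero_prod_def)
  then show ?thesis
  proof cases
    case 1
    show ?thesis
      using eqs 1 by (intro that[of "a' / a"]) (simp add: uv field_simps)
  next
    case 2
    show ?thesis
      using eqs 2 by (intro that[of "b' / b"]) (simp add: uv field_simps)
  next
    case 3
    show ?thesis
      using eqs 3 by (intro that[of "c' / c"]) (simp add: uv field_simps)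
  qed
qed

text \<open>By \<open>bracket_bracket\<close>, the bracket of \<open>bracket p q\<close> with
  \<open>u\<close> vanishes. This is the source of every uniqueness claim below: for sides, for
  altitudes, and for the form of a line up to scaling.\<close>

lemma orthogonal_complement_unique:
  assumes "pairing p u = 0" "pairing q u = 0" and "bracket p q \<noteq> 0"
  obtains k where "u = k *\<^sub>R bracket p q"
  using bracket_eq_0_imp_scaleR[of "bracket p q" u] assms
  by (auto simp: bracket_bracket)

section \<open>Points and hyperbolic lines as forms\<close>

lemma pairing_point_form_self: "pairing (point_form P) (point_form P) = - 4 * (snd P)\<^sup>2"
  by (cases P) (simp add: power2_eq_square)

lemma bracket_point_form_nonzero:
  assumes "P \<in> upper_half_plane" "Q \<in> upper_half_plane" "P \<noteq> Q"
  shows "bracket (point_form P) (point_form Q) \<noteq> 0"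
  using assms
  by (cases P; cases Q) (auto simp: upper_half_plane_def zero_prod_def)

text \<open>The orthogonal complement of a negative vector is positive definite: after eliminating
  \<open>c\<close> by incidence, the discriminant is a sum of two squares.\<close>

lemma pairing_self_pos:
  assumes "P \<in> upper_half_plane" "pairing (point_form P) u = 0" "u \<noteq> 0"
  shows "pairing u u > 0"
proof -
  obtain x y a b c where [simp]: "P = (x, y)" "u = (a, b, c)"
    by (cases P; cases u) auto
  have "y > 0"
    using assms(1) by (simp add: upper_half_plane_def)
  have c: "c = - a * (x\<^sup>2 + y\<^sup>2) - b * x"
    using assms(2) by (simp add: algebra_simps)
  have "pairing u u = (b + 2 * a * x)\<^sup>2 + (2 * a * y)\<^sup>2"
    by (simp add: c algebra_simps power2_eq_square)
  moreover have "b + 2 * a * x \<noteq> 0 \<or> 2 * a * y \<noteq> 0"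
    using \<open>y > 0\<close> c assms(3) by (auto simp: zero_prod_def)
  ultimately show ?thesis
    by (metis sum_power2_gt_zero_iff)
qed

lemma hline_scaleR: "k \<noteq> 0 \<Longrightarrow> hline (k *\<^sub>R u) = hline u"
  by (simp add: hline_def carrier_def)

text \<open>Two points pin down the form of a line up to scaling, which
  \<open>hline_eq_imp_scaleR\<close> exploits.\<close>

lemma hline_two_points:
  assumes "pairing u u > 0"
  obtains P Q where "P \<in> hline u" "Q \<in> hline u" "P \<noteq> Q"
proof -
  obtain a b c where u: "u = (a, b, c)"
    by (cases u) auto
  have disc: "b\<^sup>2 - 4 * a * c > 0"
    using assms by (simp add: u power2_eq_square)
  show ?thesis
  proof (cases "a = 0")
    case True
    with disc have "b \<noteq> 0" by auto
    then show ?thesis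
      using True
      by (intro that[of "(- c / b, 1)" "(- c / b, 2)"])
        (auto simp: u hline_def mem_carrier upper_half_plane_def)
  next
    case False
    define R where "R = sqrt (b\<^sup>2 - 4 * a * c) / (2 * \<bar>a\<bar>)"
    have "R > 0"
      using disc False by (simp add: R_def)
    have "R\<^sup>2 = (b\<^sup>2 - 4 * a * c) / (4 * a\<^sup>2)"
      using disc by (simp add: R_def power_divide power_mult_distrib)
    then have R2: "a * R\<^sup>2 = b\<^sup>2 / (4 * a) - c"
      using False by (simp add: field_simps power2_eq_square)
    \<comment> \<open>Each point \<open>(s, t)\<close> of the upper unit semicircle gives a point of
      the line; \<open>(0, 1)\<close> and the Pythagorean \<open>(3/5, 4/5)\<close> avoid further
      roots.\<close>
    have on: "(- b / (2 * a) + s * R, t * R) \<in> hline u" if "s\<^sup>2 + t\<^sup>2 = 1" "t > 0" for s t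
    proof -
      have "a * ((- b / (2 * a) + s * R)\<^sup>2 + (t * R)\<^sup>2) + b * (- b / (2 * a) + s * R) + c
        = (s\<^sup>2 + t\<^sup>2) * (a * R\<^sup>2) - b\<^sup>2 / (4 * a) + c"
        using False by (simp add: field_simps power2_eq_square)
      also have "\<dots> = 0"
        using that(1) R2 by simp
      finally show ?thesis
        using that(2) \<open>R > 0\<close> by (simp add: u hline_def mem_carrier upper_half_plane_def)
    qed
    show ?thesis
      using on[of 0 1] on[of "3/5" "4/5"] \<open>R > 0\<close>
      by (intro that[of "(- b / (2 * a) + 0 * R, 1 * R)" "(- b / (2 * a) + 3/5 * R, 4/5 * R)"])
        (auto simp: power2_eq_square)
  qed
qed

text \<open>Both forms are nonzero multiples of the bracket of two common points.\<close>

lemma hline_eq_imp_scaleR: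
  assumes "pairing u u > 0" "pairing v v > 0" "hline u = hline v"
  obtains k where "k \<noteq> 0" "v = k *\<^sub>R u"
proof -
  obtain P Q where PQ: "P \<in> hline u" "Q \<in> hline u" "P \<noteq> Q"
    using hline_two_points[OF assms(1)] .
  have nz: "bracket (point_form P) (point_form Q) \<noteq> 0"
    using PQ by (intro bracket_point_form_nonzero) (auto simp: hline_def)
  obtain i where i: "u = i *\<^sub>R bracket (point_form P) (point_form Q)"
    using PQ nz by (auto simp: hline_def carrier_def intro: orthogonal_complement_unique)
  obtain j where j: "v = j *\<^sub>R bracket (point_form P) (point_form Q)"
    using PQ nz assms(3) by (auto simp: hline_def carrier_def intro: orthogonal_complement_unique)
  have "i \<noteq> 0" "j \<noteq> 0"
    using assms(1,2) i j by auto
  then show ?thesis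
    by (intro that[of "j / i"]) (simp_all add: i j)
qed

text \<open>A real quadratic of negative discriminant has conjugate roots; \<open>P\<close> is the
  one in the upper half plane and \<open>k\<close> is the leading coefficient.\<close>

lemma negative_form_point:
  assumes "pairing w w < 0"
  obtains P k where "P \<in> upper_half_plane" "k \<noteq> 0" "w = k *\<^sub>R point_form P"
proof -
  obtain a b c where w: "w = (a, b, c)"
    by (cases w) auto
  have disc: "4 * a * c - b\<^sup>2 > 0"
    using assms by (simp add: w power2_eq_square)
  then have "a \<noteq> 0"
    by (auto simp: not_less)
  define y where "y = sqrt (4 * a * c - b\<^sup>2) / (2 * \<bar>a\<bar>)"
  have "y > 0"
    using disc \<open>a \<noteq> 0\<close> by (simp add: y_def)
  have "y\<^sup>2 = (4 * a * c - b\<^sup>2) / (4 * a\<^sup>2)"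
    using disc by (simp add: y_def power_divide power_mult_distrib)
  then have "a * ((- b / (2 * a))\<^sup>2 + y\<^sup>2) = c"
    using \<open>a \<noteq> 0\<close> by (simp add: field_simps power2_eq_square)
  then show ?thesis
    using \<open>y > 0\<close> \<open>a \<noteq> 0\<close>
    by (intro that[of "(- b / (2 * a), y)" a]) (auto simp: w upper_half_plane_def)
qed


section \<open>Euclidean carriers, their tangents, and orthogonality to the axis\<close>

lemma not_euclidean_line_sphere: "\<not> euclidean_line (sphere (c :: point) r)"
proof
  assume "euclidean_line (sphere c r)"
  then obtain p v where pv: "v \<noteq> 0" "sphere c r = range (\<lambda>t. p + t *\<^sub>R v)"
    unfolding euclidean_line_def by blast
  have "bounded (range (\<lambda>t. p + t *\<^sub>R v))"
    by (metis bounded_sphere pv(2))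
  then obtain M where M: "\<And>t. norm (p + t *\<^sub>R v) \<le> M"
    unfolding bounded_iff by blast
  \<comment> \<open>So far along the line that the triangle inequality puts the point outside the
    ball of radius \<open>M\<close>.\<close>
  define t where "t = (M + norm p + 1) / norm v"
  have "M \<ge> 0"
    using M[of 0] norm_ge_zero order_trans by blast
  then have "norm (t *\<^sub>R v) = M + norm p + 1"
    using pv(1) by (simp add: t_def)
  moreover have "norm (t *\<^sub>R v) \<le> norm (p + t *\<^sub>R v) + norm p"
    by (metis add.commute add_diff_cancel_left' norm_triangle_ineq4)
  ultimately show False
    using M[of t] by linarith
qed

lemma mem_sphere_point:
  "r > 0 \<Longrightarrow> (x, y) \<in> sphere (p, q) r \<longleftrightarrow> (x - p)\<^sup>2 + (y - q)\<^sup>2 = (r::real)\<^sup>2"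
  by (auto simp: dist_Pair_Pair dist_real_def power2_commute real_sqrt_unique)

text \<open>The two ends of the horizontal diameter are equidistant from \<open>c'\<close>, and so
  are those of the vertical one. This removes the choice of centre in
  \<open>tangent_vector\<close>.\<close>

lemma sphere_center_unique:
  fixes c c' :: point
  assumes "r > 0" "r' > 0" "sphere c r = sphere c' r'"
  shows "c = c'"
proof -
  obtain p q p' q' where c: "c = (p, q)" "c' = (p', q')"
    by (cases c; cases c') auto
  have *: "(x - p')\<^sup>2 + (y - q')\<^sup>2 = r'\<^sup>2" if "(x - p)\<^sup>2 + (y - q)\<^sup>2 = r\<^sup>2" for x y
    using that by (metis assms c mem_sphere_point)
  have "(p + r - p')\<^sup>2 + (q - q')\<^sup>2 = (p - r - p')\<^sup>2 + (q - q')\<^sup>2"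
    using *[of "p + r" q] *[of "p - r" q] by simp
  then have "r * (p - p') = 0"
    by (simp add: power2_eq_square algebra_simps)
  moreover have "(p - p')\<^sup>2 + (q + r - q')\<^sup>2 = (p - p')\<^sup>2 + (q - r - q')\<^sup>2"
    using *[of p "q + r"] *[of p "q - r"] by simp
  then have "r * (q - q') = 0"
    by (simp add: power2_eq_square algebra_simps)
  ultimately show ?thesis
    using assms(1) by (simp add: c)
qed

lemma carrier_line:
  assumes "b \<noteq> 0"
  shows "carrier (0, b, c) = range (\<lambda>t. (- c / b, y) + t *\<^sub>R (0, 1))"
  using assms by (auto simp: mem_carrier field_simps image_iff intro!: exI[of _ "_ - y"])

lemma carrier_circle:
  assumes "a \<noteq> 0" "b\<^sup>2 - 4 * a * c > 0"
  shows "carrier (a, b, c) = sphere (- b / (2 * a), 0) (sqrt (b\<^sup>2 - 4 * a * c) / (2 * \<bar>a\<bar>))"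
    (is "_ = sphere _ ?r")
proof -
  have "?r > 0"
    using assms by simp
  have r2: "?r\<^sup>2 = (b\<^sup>2 - 4 * a * c) / (4 * a\<^sup>2)"
    using assms by (simp add: power_divide power_mult_distrib)
  have "(x, y) \<in> carrier (a, b, c) \<longleftrightarrow> (x, y) \<in> sphere (- b / (2 * a), 0) ?r" for x y
    unfolding mem_sphere_point[OF \<open>?r > 0\<close>] mem_carrier r2
    using assms(1) by (simp add: field_simps power2_eq_square) algebra
  then show ?thesis by auto
qed

lemma euclidean_line_x_axis: "euclidean_line x_axis"
proof -
  have "x_axis = range (\<lambda>t. 0 + t *\<^sub>R (1, 0))"
    by (auto simp: x_axis_def)
  then show ?thesis
    unfolding euclidean_line_def by (intro exI[of _ 0] exI[of _ "(1, 0)"]) (auto simp: zero_prod_def)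
qed

lemma euclidean_line_carrier_iff:
  assumes "b\<^sup>2 - 4 * a * c > 0"
  shows "euclidean_line (carrier (a, b, c)) \<longleftrightarrow> a = 0"
proof
  show "a = 0" if "euclidean_line (carrier (a, b, c))"
    using that assms carrier_circle not_euclidean_line_sphere by metis
  assume "a = 0"
  with assms have "b \<noteq> 0" by auto
  then show "euclidean_line (carrier (a, b, c))"
    unfolding \<open>a = 0\<close> carrier_line[OF \<open>b \<noteq> 0\<close>, of c 0] euclidean_line_def
    by (intro exI[of _ "(- c / b, 0)"] exI[of _ "(0, 1)"]) (auto simp: zero_prod_def)
qed

lemma euclidean_line_or_circle_carrier:
  assumes "b\<^sup>2 - 4 * a * c > 0"
  shows "euclidean_line (carrier (a, b, c)) \<or> euclidean_circle (carrier (a, b, c))"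
proof (cases "a = 0")
  case False
  have "sqrt (b\<^sup>2 - 4 * a * c) / (2 * \<bar>a\<bar>) > 0"
    using assms False by simp
  then show ?thesis
    using carrier_circle[OF False assms] unfolding euclidean_circle_def by blast
qed (use assms euclidean_line_carrier_iff in blast)

lemma tangent_vector_line_iff:
  assumes "euclidean_line K"
  shows "tangent_vector K p v \<longleftrightarrow> p \<in> K \<and> v \<noteq> 0 \<and> K = range (\<lambda>t. p + t *\<^sub>R v)"
  using assms not_euclidean_line_sphere unfolding tangent_vector_def by metis

lemma tangent_vector_sphere_iff:
  assumes "r > 0"
  shows "tangent_vector (sphere c r) p v \<longleftrightarrow> p \<in> sphere c r \<and> v \<noteq> 0 \<and> orthogonal (p - c) v"
proof -
  have "sphere c r \<noteq> range (\<lambda>t. p + t *\<^sub>R v)" if "v \<noteq> 0"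
    using that not_euclidean_line_sphere[of c r] unfolding euclidean_line_def by blast
  then show ?thesis
    using assms sphere_center_unique unfolding tangent_vector_def by blast
qed

lemma tangent_vector_x_axis:
  "tangent_vector x_axis (x, y) (s, t) \<longleftrightarrow> y = 0 \<and> s \<noteq> 0 \<and> t = 0"
proof
  assume "tangent_vector x_axis (x, y) (s, t)"
  then have *: "(x, y) \<in> x_axis" "(s, t) \<noteq> 0" "x_axis = range (\<lambda>k. (x, y) + k *\<^sub>R (s, t))"
    by (auto simp: tangent_vector_line_iff[OF euclidean_line_x_axis])
  have "(x, y) + 1 *\<^sub>R (s, t) \<in> x_axis"
    unfolding *(3) by blast
  with * show "y = 0 \<and> s \<noteq> 0 \<and> t = 0"
    by (auto simp: x_axis_def zero_prod_def)
next
  assume st: "y = 0 \<and> s \<noteq> 0 \<and> t = 0"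
  have "(z, 0) \<in> range (\<lambda>k. (x, y) + k *\<^sub>R (s, t))" for z
    using st by (intro image_eqI[of _ _ "(z - x) / s"]) auto
  then have "x_axis = range (\<lambda>k. (x, y) + k *\<^sub>R (s, t))"
    using st by (auto simp: x_axis_def)
  then show "tangent_vector x_axis (x, y) (s, t)"
    using st unfolding tangent_vector_line_iff[OF euclidean_line_x_axis]
    by (simp add: x_axis_def zero_prod_def)
qed

text \<open>The gradient of \<open>a (x\<^sup>2 + y\<^sup>2) + b x + c\<close> is
  \<open>(2 a x + b, 2 a y)\<close>. Tangency as orthogonality to it treats lines and circles
  uniformly.\<close>

lemma tangent_vector_carrier:
  assumes "b\<^sup>2 - 4 * a * c > 0"
  shows "tangent_vector (carrier (a, b, c)) (x, y) (s, t) \<longleftrightarrow>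
    (x, y) \<in> carrier (a, b, c) \<and> (s, t) \<noteq> 0 \<and> (2 * a * x + b) * s + 2 * a * y * t = 0"
proof (cases "a = 0")
  case True
  with assms have "b \<noteq> 0" by auto
  have line: "euclidean_line (carrier (a, b, c))"
    using assms True by (simp add: euclidean_line_carrier_iff)
  have mem: "(x', y') \<in> carrier (a, b, c) \<longleftrightarrow> x' = - c / b" for x' y'
    using True \<open>b \<noteq> 0\<close> by (auto simp: mem_carrier field_simps)
  have "carrier (a, b, c) = range (\<lambda>k. (x, y) + k *\<^sub>R (s, t)) \<longleftrightarrow> s = 0"
    if x: "(x, y) \<in> carrier (a, b, c)" and "(s, t) \<noteq> 0"
  proof
    assume *: "carrier (a, b, c) = range (\<lambda>k. (x, y) + k *\<^sub>R (s, t))"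
    have "(x, y) + 1 *\<^sub>R (s, t) \<in> carrier (a, b, c)"
      unfolding * by blast
    with x show "s = 0"
      by (simp add: mem)
  next
    assume "s = 0"
    with that have "t \<noteq> 0" by (auto simp: zero_prod_def)
    have "(x, z) \<in> range (\<lambda>k. (x, y) + k *\<^sub>R (s, t))" for z
      using \<open>s = 0\<close> \<open>t \<noteq> 0\<close> by (intro image_eqI[of _ _ "(z - y) / t"]) auto
    then show "carrier (a, b, c) = range (\<lambda>k. (x, y) + k *\<^sub>R (s, t))"
      using x \<open>s = 0\<close> by (auto simp: mem)
  qed
  then show ?thesis
    unfolding tangent_vector_line_iff[OF line] using True \<open>b \<noteq> 0\<close>
    by (simp del: scaleR_Pair add_Pair) blast
next
  case False
  have "orthogonal ((x, y) - (- b / (2 * a), 0)) (s, t)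
    \<longleftrightarrow> (2 * a * x + b) * s + 2 * a * y * t = 0"
    using False by (simp add: orthogonal_def inner_Pair field_simps)
  then show ?thesis
    unfolding carrier_circle[OF False assms] using assms False
    by (subst tangent_vector_sphere_iff) auto
qed

lemma euclidean_orthogonal_carrier_x_axis:
  assumes "b\<^sup>2 - 4 * a * c > 0"
  shows "euclidean_orthogonal (carrier (a, b, c)) x_axis"
proof -
  have "\<exists>x. a * x\<^sup>2 + b * x + c = 0"
  proof (cases "a = 0")
    case True
    with assms have "b \<noteq> 0" by auto
    then show ?thesis
      using True by (intro exI[of _ "- c / b"]) simp
  next
    case False
    then show ?thesis
      using assms discriminant_nonneg_ex[of a b c] by (auto simp: discrim_def)
  qed
  then obtain x where "(x, 0) \<in> carrier (a, b, c) \<inter> x_axis"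
    by (auto simp: mem_carrier x_axis_def)
  moreover have "orthogonal v w"
    if *: "p \<in> carrier (a, b, c) \<inter> x_axis" "tangent_vector (carrier (a, b, c)) p v"
      "tangent_vector x_axis p w" for p v w
  proof -
    obtain x y s t s' t' where [simp]: "p = (x, y)" "v = (s, t)" "w = (s', t')"
      by (cases p; cases v; cases w) auto
    have y: "y = 0" "t' = 0"
      using *(3) by (auto simp: tangent_vector_x_axis)
    have "(2 * a * x + b) * s = 0"
      using *(2) y by (simp add: tangent_vector_carrier[OF assms])
    moreover have "a * x\<^sup>2 + b * x + c = 0"
      using *(1) y by (simp add: mem_carrier)
    \<comment> \<open>At a root, the squared derivative equals the discriminant. Hence the gradient
      on the axis is horizontal and nonzero, and tangents there are vertical.\<close>
    then have "(2 * a * x + b)\<^sup>2 = b\<^sup>2 - 4 * a * c"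
      by algebra
    with assms have "2 * a * x + b \<noteq> 0" by auto
    ultimately show ?thesis
      using y by (simp add: orthogonal_def inner_Pair)
  qed
  ultimately show ?thesis
    using euclidean_line_or_circle_carrier[OF assms] euclidean_line_x_axis
    unfolding euclidean_orthogonal_def by blast
qed

lemma euclidean_orthogonal_x_axis_imp_carrier:
  assumes "euclidean_orthogonal K x_axis"
  obtains u where "pairing u u > 0" "K = carrier u"
proof -
  obtain x where x: "(x, 0) \<in> K"
    using assms by (auto simp: euclidean_orthogonal_def x_axis_def)
  have orth: "orthogonal v (1, 0)" if "tangent_vector K (x, 0) v" for v
  proof -
    have "(x, 0) \<in> K \<inter> x_axis" "tangent_vector x_axis (x, 0) (1, 0)"
      using x by (simp_all add: x_axis_def[THEN eqset_imp_iff] tangent_vector_x_axis)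
    then show ?thesis
      using assms that unfolding euclidean_orthogonal_def by blast
  qed
  consider "euclidean_line K" | "euclidean_circle K"
    using assms by (auto simp: euclidean_orthogonal_def)
  then show ?thesis
  proof cases
    case 1
    then obtain p v where v: "v \<noteq> 0" and K: "K = range (\<lambda>t. p + t *\<^sub>R v)"
      unfolding euclidean_line_def by blast
    \<comment> \<open>Rebase the parametrization at the point on the axis, as
      \<open>tangent_vector\<close> demands.\<close>
    obtain k where k: "(x, 0) = p + k *\<^sub>R v"
      using x K by auto
    have "p + t *\<^sub>R v = (x, 0) + (t - k) *\<^sub>R v" for t
      by (simp add: k algebra_simps)
    moreover have "(x, 0) + t *\<^sub>R v = p + (t + k) *\<^sub>R v" for t
      by (simp add: k algebra_simps)
    ultimately have K': "K = range (\<lambda>t. (x, 0) + t *\<^sub>R v)"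
      unfolding K by (metis (no_types, lifting) image_subset_iff rangeI subset_antisym)
    have "orthogonal v (1, 0)"
      using K' x v by (intro orth) (simp add: tangent_vector_def)
    then obtain s where s: "v = (0, s)" "s \<noteq> 0"
      using v by (cases v) (auto simp: orthogonal_def inner_Pair zero_prod_def)
    have "(x, y) \<in> K" for y
      unfolding K' s(1) using s(2) by (intro image_eqI[of _ _ "y / s"]) auto
    then have "K = carrier (0, 1, - x)"
      by (auto simp: mem_carrier) (auto simp: K' s(1))
    then show ?thesis
      by (intro that[of "(0, 1, - x)"]) auto
  next
    case 2
    then obtain p q r where r: "r > 0" and K: "K = sphere (p, q) r"
      unfolding euclidean_circle_def by auto
    have sph: "(x - p)\<^sup>2 + q\<^sup>2 = r\<^sup>2"
      using x r by (simp add: K mem_sphere_point del: mem_sphere)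
    \<comment> \<open>The radius \<open>(x - p, - q)\<close> turned by a quarter: a tangent at
      \<open>(x, 0)\<close>. It is vertical only if the centre lies on the axis.\<close>
    then have nz: "(q, x - p) \<noteq> 0"
      using r by (auto simp: zero_prod_def)
    have "orthogonal (q, x - p) (1, 0)"
      using x nz r by (intro orth)
        (simp add: K tangent_vector_sphere_iff orthogonal_def inner_Pair algebra_simps del: mem_sphere)
    then have "q = 0"
      by (simp add: orthogonal_def inner_Pair)
    have "(x', y') \<in> K \<longleftrightarrow> (x', y') \<in> carrier (1, - 2 * p, p\<^sup>2 - r\<^sup>2)" for x' y'
      unfolding K mem_sphere_point[OF r] mem_carrier \<open>q = 0\<close>
      by (simp add: power2_eq_square algebra_simps)
    then have "K = carrier (1, - 2 * p, p\<^sup>2 - r\<^sup>2)" by auto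
    then show ?thesis
      using r by (intro that[of "(1, - 2 * p, p\<^sup>2 - r\<^sup>2)"]) (auto simp: power2_eq_square)
  qed
qed

section \<open>Hyperbolic lines and orthogonality in terms of forms\<close>

lemma pairing_self_eq: "pairing (a, b, c) (a, b, c) = b\<^sup>2 - 4 * a * c"
  by (simp add: power2_eq_square)

lemma carries_iff:
  "carries K l \<longleftrightarrow> (\<exists>u. pairing u u > 0 \<and> K = carrier u \<and> l = hline u)"
proof
  assume "carries K l"
  then show "\<exists>u. pairing u u > 0 \<and> K = carrier u \<and> l = hline u"
    unfolding carries_def hline_def by (metis euclidean_orthogonal_x_axis_imp_carrier)
next
  assume "\<exists>u. pairing u u > 0 \<and> K = carrier u \<and> l = hline u"
  then obtain a b c where u: "pairing (a, b, c) (a, b, c) > 0" "K = carrier (a, b, c)" "l = hline (a, b, c)"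
    by auto
  show "carries K l"
    using euclidean_line_or_circle_carrier euclidean_orthogonal_carrier_x_axis u
    unfolding carries_def hline_def pairing_self_eq by blast
qed

lemma hyperbolic_line_iff: "hyperbolic_line l \<longleftrightarrow> (\<exists>u. pairing u u > 0 \<and> l = hline u)"
  by (auto simp: hyperbolic_line_def carries_iff)

text \<open>A hyperbolic line determines its Euclidean carrier, so the existential quantifiers over
  carriers in \<open>hyperbolic_orthogonal\<close> and \<open>boundary_point_on\<close>
  collapse.\<close>

lemma carries_hline_iff:
  assumes "pairing u u > 0"
  shows "carries K (hline u) \<longleftrightarrow> K = carrier u"
proof
  assume "carries K (hline u)"
  then obtain v where v: "pairing v v > 0" "K = carrier v" "hline u = hline v"
    by (auto simp: carries_iff)
  obtain k where "k \<noteq> 0" "v = k *\<^sub>R u"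
    using hline_eq_imp_scaleR[OF assms v(1,3)] .
  then show "K = carrier u"
    by (simp add: v(2) carrier_def)
qed (use assms carries_iff in blast)

text \<open>At a common point the inner product of the gradients equals \<open>pairing u v\<close>.
  Conversely, a vanishing pairing itself forces a common point to exist.\<close>

lemma euclidean_orthogonal_carrier_iff:
  assumes "pairing u u > 0" "pairing v v > 0"
  shows "euclidean_orthogonal (carrier u) (carrier v) \<longleftrightarrow> pairing u v = 0"
proof -
  obtain a b c a' b' c' where uv: "u = (a, b, c)" "v = (a', b', c')"
    by (cases u; cases v) auto
  note disc = assms[unfolded uv pairing_self_eq]
  have gradients: "(2 * a * x + b) * (2 * a' * x + b') + 2 * a * y * (2 * a' * y) = pairing u v"
    if "(x, y) \<in> carrier u" "(x, y) \<in> carrier v" for x y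
  proof -
    have "(2 * a * x + b) * (2 * a' * x + b') + 2 * a * y * (2 * a' * y) - pairing u v
      = 2 * a' * (a * (x\<^sup>2 + y\<^sup>2) + b * x + c) + 2 * a * (a' * (x\<^sup>2 + y\<^sup>2) + b' * x + c')"
      by (simp add: uv power2_eq_square algebra_simps)
    then show ?thesis
      using that by (simp add: uv mem_carrier)
  qed
  show ?thesis
  proof
    assume orth: "euclidean_orthogonal (carrier u) (carrier v)"
    then obtain x y where xy: "(x, y) \<in> carrier u" "(x, y) \<in> carrier v"
      unfolding euclidean_orthogonal_def by auto
    \<comment> \<open>The gradients turned by a quarter, hence tangent vectors wherever they are
      nonzero.\<close>
    define g where "g = (- 2 * a * y, 2 * a * x + b)"
    define g' where "g' = (- 2 * a' * y, 2 * a' * x + b')"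
    show "pairing u v = 0"
    proof (cases "g = 0 \<or> g' = 0")
      case True
      then show ?thesis
        using gradients[OF xy] by (auto simp: g_def g'_def zero_prod_def)
    next
      case False
      then have "tangent_vector (carrier u) (x, y) g" "tangent_vector (carrier v) (x, y) g'"
        using xy disc by (auto simp: g_def g'_def tangent_vector_carrier uv algebra_simps)
      then have "orthogonal g g'"
        using orth xy unfolding euclidean_orthogonal_def by blast
      then show ?thesis
        using gradients[OF xy] by (simp add: g_def g'_def orthogonal_def inner_Pair algebra_simps)
    qed
  next
    assume uv0: "pairing u v = 0"
    \<comment> \<open>By Lagrange's identity the bracket is negative, so it represents a point,
      which lies on both carriers.\<close>
    have "pairing (bracket u v) (bracket u v) < 0"
      using assms by (simp add: pairing_bracket_self uv0)
    then obtain P k where P: "k \<noteq> 0" "bracket u v = k *\<^sub>R point_form P"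
      using negative_form_point by blast
    have "k * pairing (point_form P) u = 0" "k * pairing (point_form P) v = 0"
      using pairing_bracket(3,4)[of u v] unfolding P(2) by simp_all
    then have "P \<in> carrier u \<inter> carrier v"
      using P(1) by (simp add: carrier_def)
    moreover have "orthogonal f g"
      if *: "p \<in> carrier u \<inter> carrier v" "tangent_vector (carrier u) p f"
        "tangent_vector (carrier v) p g" for p f g
    proof -
      obtain x y s t s' t' where [simp]: "p = (x, y)" "f = (s, t)" "g = (s', t')"
        by (cases p; cases f; cases g) auto
      define A B A' B' where "A = 2 * a * x + b" and "B = 2 * a * y"
        and "A' = 2 * a' * x + b'" and "B' = 2 * a' * y"
      have f: "A * s + B * t = 0" and g: "A' * s' + B' * t' = 0"
        using *(2,3) disc by (auto simp: uv tangent_vector_carrier A_def B_def A'_def B'_def)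
      have AB: "A * A' + B * B' = 0"
        using gradients[of x y] *(1) uv0 by (simp add: A_def B_def A'_def B'_def)
      \<comment> \<open>The squared length of the gradient is the discriminant plus a multiple of
        the defining polynomial, hence positive on the curve.\<close>
      have "A\<^sup>2 + B\<^sup>2 = b\<^sup>2 - 4 * a * c + 4 * a * (a * (x\<^sup>2 + y\<^sup>2) + b * x + c)"
        by (simp add: A_def B_def power2_eq_square algebra_simps)
      then have nz: "A\<^sup>2 + B\<^sup>2 > 0"
        using *(1) disc by (simp add: uv mem_carrier)
      have "A'\<^sup>2 + B'\<^sup>2 = b'\<^sup>2 - 4 * a' * c' + 4 * a' * (a' * (x\<^sup>2 + y\<^sup>2) + b' * x + c')"
        by (simp add: A'_def B'_def power2_eq_square algebra_simps)
      then have nz': "A'\<^sup>2 + B'\<^sup>2 > 0"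
        using *(1) disc by (simp add: uv mem_carrier)
      \<comment> \<open>In the plane, vectors perpendicular to two perpendicular nonzero gradients
        are themselves perpendicular.\<close>
      have "(A\<^sup>2 + B\<^sup>2) * (A'\<^sup>2 + B'\<^sup>2) * (s * s' + t * t') = 0"
        using f g AB by algebra
      then show ?thesis
        using nz nz' by (simp only: mult_eq_0_iff orthogonal_def inner_Pair inner_real_def) auto
    qed
    ultimately show "euclidean_orthogonal (carrier u) (carrier v)"
      using euclidean_line_or_circle_carrier disc unfolding euclidean_orthogonal_def uv by blast
  qed
qed

lemma hyperbolic_orthogonal_hline_iff:
  assumes "pairing u u > 0" "pairing v v > 0"
  shows "hyperbolic_orthogonal (hline u) (hline v) \<longleftrightarrow> pairing u v = 0"
  using assms
  by (simp add: hyperbolic_orthogonal_def carries_hline_iff euclidean_orthogonal_carrier_iff)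

section \<open>Boundary points as null forms\<close>

text \<open>The quadratics with a double root at \<open>x\<close> or at infinity. Pairing
  \<open>(0, 0, 1)\<close> with \<open>(a, b, c)\<close> gives \<open>- 2 a\<close>, which vanishes
  exactly on vertical lines.\<close>

fun boundary_form :: "boundary_point \<Rightarrow> form" where
  "boundary_form (Axis_Point x) = (1, - 2 * x, x\<^sup>2)"
| "boundary_form Infinity_Point = (0, 0, 1)"

lemma boundary_point_on_hline_iff:
  assumes "pairing u u > 0"
  shows "boundary_point_on q (hline u) \<longleftrightarrow> pairing (boundary_form q) u = 0"
proof (cases q)
  case (Axis_Point x)
  then show ?thesis
    using assms by (cases u) (simp add: carries_hline_iff carrier_def)
next
  case Infinity_Point
  then show ?thesis
    using assms
    by (cases u) (simp add: carries_hline_iff euclidean_line_carrier_iff pairing_self_eq del: pairing.simps,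
        simp)
qed

text \<open>Zero discriminant means a double root, at infinity if the leading coefficient
  vanishes.\<close>

lemma null_form_boundary_point:
  assumes "pairing w w = 0" "w \<noteq> 0"
  obtains q k where "k \<noteq> 0" "w = k *\<^sub>R boundary_form q"
proof -
  obtain a b c where w: "w = (a, b, c)"
    by (cases w) auto
  have disc: "b\<^sup>2 = 4 * a * c"
    using assms by (simp add: w power2_eq_square)
  show ?thesis
  proof (cases "a = 0")
    case True
    then show ?thesis
      using disc assms by (intro that[of c Infinity_Point]) (auto simp: w zero_prod_def)
  next
    case False
    then show ?thesis
      using disc by (intro that[of a "Axis_Point (- b / (2 * a))"])
        (auto simp: w field_simps power2_eq_square)
  qed
qed

section \<open>Sides and altitudes as brackets\<close>

lemma side_eq:
  assumes "P \<in> upper_half_plane" "Q \<in> upper_half_plane" "P \<noteq> Q"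
  defines "u \<equiv> bracket (point_form P) (point_form Q)"
  shows "side P Q = hline u" "pairing u u > 0" "P \<in> hline u" "Q \<in> hline u"
proof -
  have nz: "u \<noteq> 0"
    unfolding u_def using assms(1-3) by (rule bracket_point_form_nonzero)
  then show pos: "pairing u u > 0"
    using assms(1) by (intro pairing_self_pos[of P]) (simp_all add: u_def)
  show mem: "P \<in> hline u" "Q \<in> hline u"
    using assms(1,2) by (simp_all add: hline_def carrier_def u_def)
  show "side P Q = hline u"
    unfolding side_def
  proof (rule the_equality)
    show "hyperbolic_line (hline u) \<and> P \<in> hline u \<and> Q \<in> hline u"
      using mem pos hyperbolic_line_iff by blast
    fix l assume l: "hyperbolic_line l \<and> P \<in> l \<and> Q \<in> l"
    then obtain v where v: "pairing v v > 0" "l = hline v"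
      by (auto simp: hyperbolic_line_iff)
    obtain k where k: "v = k *\<^sub>R u"
      using l v nz unfolding u_def
      by (auto simp: hline_def carrier_def intro: orthogonal_complement_unique)
    with v have "k \<noteq> 0" by auto
    then show "l = hline u"
      by (simp add: v k hline_scaleR)
  qed
qed

text \<open>Passing through \<open>A\<close> and being orthogonal to the side are two linear
  conditions on a form, solved up to scaling by the bracket of \<open>A\<close> with the
  side.\<close>

lemma altitude_eq:
  assumes "hyperbolic_triangle A B C"
  defines "u \<equiv> bracket (point_form A) (bracket (point_form B) (point_form C))"
  shows "altitude A B C = hline u" "pairing u u > 0"
proof -
  have H: "A \<in> upper_half_plane" "B \<in> upper_half_plane" "C \<in> upper_half_plane"
    using assms(1) by (auto simp: hyperbolic_triangle_def)
  have "B \<noteq> C"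
  proof
    assume "B = C"
    \<comment> \<open>If \<open>B = C\<close>, the line through \<open>A\<close> and
      \<open>Q\<close> contains all three vertices; \<open>Q\<close> is \<open>B\<close>, or a
      translate of \<open>A\<close> when all of them coincide.\<close>
    obtain Q where "Q \<in> upper_half_plane" "Q \<noteq> A" "B = A \<or> Q = B"
    proof (cases "B = A")
      case True
      then show ?thesis
        using H by (intro that[of "A + (1, 0)"])
          (auto simp: upper_half_plane_def plus_prod_def zero_prod_def prod_eq_iff)
    qed (use H that in blast)
    then show False
      using side_eq[of A Q] H \<open>B = C\<close> assms(1)
      unfolding hyperbolic_triangle_def hyperbolic_line_iff by metis
  qed
  define s where "s = bracket (point_form B) (point_form C)"
  note side = side_eq[OF H(2,3) \<open>B \<noteq> C\<close>, folded s_def]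
  have nz: "u \<noteq> 0"
  proof
    assume "u = 0"
    then have "bracket (point_form A) s = 0"
      by (simp add: u_def s_def)
    then have "pairing (bracket (point_form A) s) (bracket (point_form A) s) = 0"
      by (simp add: zero_prod_def)
    \<comment> \<open>A negative and a positive vector cannot be proportional: Lagrange's identity
      would make a square negative.\<close>
    then have "(pairing (point_form A) s)\<^sup>2 = - 4 * (snd A)\<^sup>2 * pairing s s"
      by (simp add: pairing_bracket_self pairing_point_form_self)
    moreover have "(snd A)\<^sup>2 * pairing s s > 0"
      using H(1) side(2) by (auto simp: upper_half_plane_def)
    ultimately show False
      using zero_le_power2[of "pairing (point_form A) s"] by linarith
  qed
  then show pos: "pairing u u > 0"
    using H(1) by (intro pairing_self_pos[of A]) (simp_all add: u_def)
  have mem: "A \<in> hline u"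
    using H by (simp add: hline_def carrier_def u_def)
  show "altitude A B C = hline u"
    unfolding altitude_def side(1)
  proof (rule the_equality)
    show "hyperbolic_line (hline u) \<and> A \<in> hline u \<and> hyperbolic_orthogonal (hline u) (hline s)"
      using mem pos side(2)
        hyperbolic_orthogonal_hline_iff[OF pos side(2)] pairing_bracket(4) hyperbolic_line_iff
      unfolding u_def s_def by blast
    fix l assume l: "hyperbolic_line l \<and> A \<in> l \<and> hyperbolic_orthogonal l (hline s)"
    then obtain v where v: "pairing v v > 0" "l = hline v"
      by (auto simp: hyperbolic_line_iff)
    have "pairing (point_form A) v = 0"
      using l v by (simp add: hline_def carrier_def)
    moreover have "pairing s v = 0"
      using l v side(2) hyperbolic_orthogonal_hline_iff pairing_commute by metis
    ultimately obtain k where k: "v = k *\<^sub>R u"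
      using nz unfolding u_def s_def by (auto intro: orthogonal_complement_unique)
    with v have "k \<noteq> 0" by auto
    then show "l = hline u"
      by (simp add: v k hline_scaleR)
  qed
qed

section \<open>Relative position of two lines, and concurrence of three\<close>

text \<open>The bracket pairs to zero with both forms, so it is itself the common point, common
  boundary point or common perpendicular, according to its sign.\<close>

lemma two_hlines_trichotomy:
  assumes "pairing u u > 0" "pairing v v > 0"
  shows "(\<exists>p \<in> upper_half_plane. p \<in> hline u \<and> p \<in> hline v) \<or>
    (\<exists>q. boundary_point_on q (hline u) \<and> boundary_point_on q (hline v)) \<or>
    (\<exists>m. hyperbolic_line m \<and> hyperbolic_orthogonal (hline u) m \<and> hyperbolic_orthogonal (hline v) m)"
proof -
  define w where "w = bracket u v"
  have w: "pairing w u = 0" "pairing w v = 0"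
    by (simp_all add: w_def)
  consider "pairing w w < 0" | "pairing w w = 0" "w \<noteq> 0" | "w = 0" | "pairing w w > 0"
    by linarith
  then show ?thesis
  proof cases
    case 1
    then obtain P k where "P \<in> upper_half_plane" "k \<noteq> 0" "w = k *\<^sub>R point_form P"
      by (rule negative_form_point)
    with w have "P \<in> upper_half_plane" "P \<in> hline u" "P \<in> hline v"
      by (auto simp: hline_def carrier_def)
    then show ?thesis by blast
  next
    case 2
    then obtain q k where "k \<noteq> 0" "w = k *\<^sub>R boundary_form q"
      by (rule null_form_boundary_point)
    with w show ?thesis
      by (auto simp: boundary_point_on_hline_iff assms)
  next
    \<comment> \<open>The two lines coincide, so any of their points is common.\<close>
    case 3
    have "u \<noteq> 0"
      using assms(1) by (auto simp: zero_prod_def)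
    with 3 obtain k where k: "v = k *\<^sub>R u"
      using bracket_eq_0_imp_scaleR unfolding w_def by blast
    with assms(2) have "k \<noteq> 0" by auto
    then show ?thesis
      using hline_two_points[OF assms(1)] by (metis IntD2 hline_def hline_scaleR k)
  next
    case 4
    then show ?thesis
      using w assms hyperbolic_line_iff hyperbolic_orthogonal_hline_iff pairing_commute by metis
  qed
qed

text \<open>Each property says that the pairing with a fixed form vanishes:
  \<open>point_form p\<close>, \<open>boundary_form q\<close> or the form of \<open>m\<close>. The
  pairing is additive, so the zero sum carries this over to \<open>w\<close>.\<close>

lemma pencil_closed:
  assumes pos: "pairing u u > 0" "pairing v v > 0" "pairing w w > 0" and sum: "u + v + w = 0"
  shows "p \<in> hline u \<Longrightarrow> p \<in> hline v \<Longrightarrow> p \<in> hline w"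
    and "boundary_point_on q (hline u) \<Longrightarrow> boundary_point_on q (hline v)
      \<Longrightarrow> boundary_point_on q (hline w)"
    and "hyperbolic_line m \<Longrightarrow> hyperbolic_orthogonal (hline u) m
      \<Longrightarrow> hyperbolic_orthogonal (hline v) m \<Longrightarrow> hyperbolic_orthogonal (hline w) m"
proof -
  have *: "pairing z w = 0" if "pairing z u = 0" "pairing z v = 0" for z
    using that arg_cong[OF sum, of "pairing z"]
    by (cases z) (simp add: pairing_add_right zero_prod_def)
  show "p \<in> hline u \<Longrightarrow> p \<in> hline v \<Longrightarrow> p \<in> hline w"
    using * by (auto simp: hline_def carrier_def)
  show "boundary_point_on q (hline u) \<Longrightarrow> boundary_point_on q (hline v)
      \<Longrightarrow> boundary_point_on q (hline w)"
    using * by (simp add: boundary_point_on_hline_iff pos)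
  show "hyperbolic_line m \<Longrightarrow> hyperbolic_orthogonal (hline u) m
      \<Longrightarrow> hyperbolic_orthogonal (hline v) m \<Longrightarrow> hyperbolic_orthogonal (hline w) m"
    using * pos by (auto simp: hyperbolic_line_iff hyperbolic_orthogonal_hline_iff pairing_commute)
qed

theorem mainTheorem3:
  fixes A B C :: "real \<times> real"
    and a b c :: "(real \<times> real) set"
    and T :: "((real \<times> real) set \<times> (real \<times> real) set \<times> (real \<times> real) set) set"
  assumes "hyperbolic_triangle A B C"
    and "a = altitude A B C" and "b = altitude B C A" and "c = altitude C A B"
    and "T = {(a, b, c), (b, c, a), (c, a, b)}"
  shows "((\<exists>(f, g, h) \<in> T. \<exists>p \<in> upper_half_plane. p \<in> f \<and> p \<in> g) \<or>
          (\<exists>(f, g, h) \<in> T. \<exists>q. boundary_point_on q f \<and> boundary_point_on q g) \<or>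
          (\<exists>(f, g, h) \<in> T. \<exists>m. hyperbolic_line m \<and>
              hyperbolic_orthogonal f m \<and> hyperbolic_orthogonal g m)) \<and>
         (\<forall>(f, g, h) \<in> T. \<forall>p \<in> upper_half_plane. p \<in> f \<and> p \<in> g \<longrightarrow> p \<in> h) \<and>
         (\<forall>(f, g, h) \<in> T. \<forall>q. boundary_point_on q f \<and> boundary_point_on q g \<longrightarrow>
              boundary_point_on q h) \<and>
         (\<forall>(f, g, h) \<in> T. \<forall>m. hyperbolic_line m \<and>
              hyperbolic_orthogonal f m \<and> hyperbolic_orthogonal g m \<longrightarrow>
              hyperbolic_orthogonal h m)"
proof -
  define u v w where "u = bracket (point_form A) (bracket (point_form B) (point_form C))"
    and "v = bracket (point_form B) (bracket (point_form C) (point_form A))"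
    and "w = bracket (point_form C) (bracket (point_form A) (point_form B))"
  have BCA: "hyperbolic_triangle B C A" and CAB: "hyperbolic_triangle C A B"
    using assms(1) unfolding hyperbolic_triangle_def by blast+
  have abc: "a = hline u" "b = hline v" "c = hline w"
    using assms altitude_eq(1)[OF assms(1)] altitude_eq(1)[OF BCA] altitude_eq(1)[OF CAB]
    by (simp_all add: u_def v_def w_def)
  have pos: "pairing u u > 0" "pairing v v > 0" "pairing w w > 0"
    using altitude_eq(2)[OF assms(1)] altitude_eq(2)[OF BCA] altitude_eq(2)[OF CAB]
    by (simp_all only: u_def v_def w_def)
  \<comment> \<open>One Jacobi identity in three cyclic arrangements, one for each triple in
    \<open>T\<close>.\<close>
  have sum: "u + v + w = 0" "v + w + u = 0" "w + u + v = 0"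
    using bracket_jacobi[of "point_form A" "point_form B" "point_form C"]
    by (simp_all only: u_def v_def w_def ac_simps)
  show ?thesis
    using two_hlines_trichotomy[OF pos(1,2)]
      pencil_closed[OF pos(1,2,3) sum(1)] pencil_closed[OF pos(2,3,1) sum(2)]
      pencil_closed[OF pos(3,1,2) sum(3)]
    unfolding assms(5) abc by simp blast
qed

end
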